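(* Let $m,n$ be square-free positive integers with $\gcd(m,n)=1$ and $N\varepsilon_{mn}=1$, such that every prime $p\mid m$ satisfies $p\equiv1\pmod4$. Let \[P=\{p\text{ prime}:p\mid m,\ (n/p)=-1\}\cup\{q\text{ prime}:q\mid n,\ (m/q)=-1\}\cup P_2,\] where $P_2=\{2\}$ if $m\equiv5\pmod8$ and $n\equiv3\pmod4$, and $P_2=\emptyset$ otherwise. Let $F=\mathbb{Q}(\sqrt{mn})$ and let $d$ be a square-free positive integer with $F(\sqrt{\varepsilon_{mn}})=F(\sqrt d)$, where $d\mid 2mn$ if $n\equiv3\pmod4$ and $d\mid mn$ otherwise. Let $D$ be the set of prime divisors of $d$. Then $|D\cap P|$ is even.
   Context: $\varepsilon_{mn}$ is the positive (real, $\sqrt{mn}>0$) fundamental unit of $\mathbb{Q}(\sqrt{mn})$, $N\varepsilon_{mn}$ its norm to $\mathbb{Q}$; fields are subfields of $\mathbb{R}$. $(x/p)$ is the Legendre symbol for an odd prime $p\nmid x$; for odd $x$, $(x/2)=+1$ if $x\equiv\pm1\pmod8$ and $-1$ if $x\equiv\pm5\pmod8$. *)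

theory Defs
  imports
    Complex_Main
    "HOL-Algebra.Algebraic_Closure_Type"
    "HOL-Algebra.Generated_Fields"
    "HOL-Computational_Algebra.Computational_Algebra"
    "HOL-Number_Theory.Number_Theory"
begin

definition adjoin :: "real set \<Rightarrow> real \<Rightarrow> real set" where
  "adjoin K x = generate_field ring_of_type_algebra (insert x K)"

abbreviation quad_field :: "nat \<Rightarrow> real set" where
  "quad_field D \<equiv> adjoin \<rat> (sqrt (real D))"

definition ring_of_integers :: "real set \<Rightarrow> real set" where
  "ring_of_integers K = {x \<in> K. algebraic_int x}"

definition integer_units :: "real set \<Rightarrow> real set" where
  "integer_units K = {u \<in> ring_of_integers K. \<exists>v \<in> ring_of_integers K. u * v = 1}"

text \<open>
  A fundamental unit generates the units of the ring of integers up to sign. For a real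
  quadratic field the positive ones are \<open>\<epsilon>\<close> and \<open>1/\<epsilon>\<close>, where \<open>\<epsilon> > 1\<close>. They have the same
  norm and their square roots generate the same extension, so neither is singled out.
\<close>

definition positive_fundamental_unit :: "real set \<Rightarrow> real \<Rightarrow> bool" where
  "positive_fundamental_unit K e \<longleftrightarrow>
     e \<in> integer_units K \<and> e > 0 \<and>
     (\<forall>u \<in> integer_units K. \<exists>k::int. u = e powi k \<or> u = - (e powi k))"

text \<open>
  The norm from \<open>\<rat>(\<surd>D)\<close> to \<open>\<rat>\<close>, as the product of the two conjugates. The rational
  coordinates \<open>a\<close>, \<open>b\<close> are unique provided that \<open>D\<close> is not a perfect square.
\<close>

definition quad_norm :: "nat \<Rightarrow> real \<Rightarrow> real" where
  "quad_norm D x =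
     (THE N. \<exists>a\<in>\<rat>. \<exists>b\<in>\<rat>. x = a + b * sqrt (real D) \<and>
        N = (a + b * sqrt (real D)) * (a - b * sqrt (real D)))"

text \<open>The library's \<open>Legendre a 2\<close> is \<open>1\<close> for every odd \<open>a\<close>, so the prime 2 is treated apart.\<close>

definition quad_symbol :: "nat \<Rightarrow> nat \<Rightarrow> int" where
  "quad_symbol x p =
     (if p = 2 then
        (if x mod 8 = 1 \<or> x mod 8 = 7 then 1
         else if x mod 8 = 3 \<or> x mod 8 = 5 then -1
         else 0)
      else Legendre (int x) (int p))"

definition P_two :: "nat \<Rightarrow> nat \<Rightarrow> nat set" where
  "P_two m n = (if m mod 8 = 5 \<and> n mod 4 = 3 then {2} else {})"

definition P_set :: "nat \<Rightarrow> nat \<Rightarrow> nat set" where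
  "P_set m n =
     {p. prime p \<and> p dvd m \<and> quad_symbol n p = -1} \<union>
     {q. prime q \<and> q dvd n \<and> quad_symbol m q = -1} \<union>
     P_two m n"

end

theory Submission
  imports Defs
begin

text \<open>
  Equality of the two extensions makes \<open>d \<epsilon>\<close> a square in \<open>F\<close>, and taking norms gives a
  primitive integral solution of \<open>a\<^sup>2 - m n b\<^sup>2 = \<plusminus>d c\<^sup>2\<close>. In terms of Hilbert symbols,
  \<open>(m n, \<plusminus>d)\<^sub>v = 1\<close> at every place, while \<open>(m, -1)\<^sub>v = 1\<close> because \<open>m\<close> is a product of
  primes congruent to 1 modulo 4. Hence \<open>(m, d)\<^sub>v = (n, \<plusminus>d)\<^sub>v\<close>, the places where this is
  \<open>-1\<close> are exactly the elements of \<open>P\<close> that divide \<open>d\<close>, and by the product formula their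
  number is even. The product formula is used in the form of quadratic reciprocity, after
  splitting \<open>d = d\<^sub>1 d\<^sub>2\<close> and \<open>m = d\<^sub>1 m'\<close> with \<open>d\<^sub>1 = gcd d m\<close>.
\<close>

section \<open>Quadratic residue symbols\<close>

lemma Legendre_cong: "[a = b] (mod p) \<Longrightarrow> Legendre a p = Legendre b p"
  by (simp add: Legendre_def QuadRes_def cong_def)

lemma Legendre_values: "Legendre a p \<in> {-1, 0, 1}"
  by (simp add: Legendre_def)

lemma Legendre_eq_0_iff: "Legendre a p = 0 \<longleftrightarrow> p dvd a"
  by (simp add: Legendre_def cong_0_iff)

text \<open>Distinct elements of {-1, 0, 1} differ by at most 2, so a modulus above 2 separates
  them. This lifts Euler's criterion to an equality of symbols.\<close>

lemma sign_cong_imp_eq: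
  fixes x y p :: int
  assumes "[x = y] (mod p)" "x \<in> {-1, 0, 1}" "y \<in> {-1, 0, 1}" "p > 2"
  shows "x = y"
proof (rule ccontr)
  assume "x \<noteq> y"
  moreover have "p dvd x - y"
    using assms(1) by (simp add: cong_iff_dvd_diff)
  ultimately have "\<bar>p\<bar> \<le> \<bar>x - y\<bar>"
    by (intro dvd_imp_le_int) auto
  then show False using assms(2-4) by auto
qed

lemma Legendre_mult:
  assumes "prime p" "2 < p"
  shows "Legendre (a * b) (int p) = Legendre a (int p) * Legendre b (int p)"
proof (rule sign_cong_imp_eq)
  note euler = euler_criterion[OF assms]
  have "[Legendre a (int p) * Legendre b (int p) = (a * b) ^ ((p - 1) div 2)] (mod int p)"
    unfolding power_mult_distrib by (intro cong_mult euler)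
  then show "[Legendre (a * b) (int p) = Legendre a (int p) * Legendre b (int p)] (mod int p)"
    using euler[of "a * b"] cong_sym cong_trans by blast
  show "Legendre (a * b) (int p) \<in> {-1, 0, 1}"
    by (rule Legendre_values)
  show "Legendre a (int p) * Legendre b (int p) \<in> {-1, 0, 1}"
    using Legendre_values[of a "int p"] Legendre_values[of b "int p"] by auto
qed (use assms in simp)

lemma Legendre_minus_1:
  assumes "prime p" "p mod 4 = 1"
  shows "Legendre (-1) (int p) = 1"
proof (rule sign_cong_imp_eq)
  have p2: "2 < p"
    using assms prime_ge_2_nat[of p] by (cases "p = 2") auto
  have "even ((p - 1) div 2)"
    using assms(2) by presburger
  then show "[Legendre (-1) (int p) = 1] (mod int p)"
    using euler_criterion[OF assms(1) p2, of "-1"] by simp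
  show "int p > 2" using p2 by simp
qed (use Legendre_values in auto)

text \<open>Gauss's lemma with multiplier 2: for \<open>p = 4 * k + 1\<close> the exponent counts
  the doubled residues beyond \<open>(p - 1) div 2 = 2 * k\<close>.\<close>

lemma Legendre_2:
  assumes "prime p" "p mod 4 = 1"
  shows "Legendre 2 (int p) = (if p mod 8 = 1 then 1 else -1)"
proof -
  define k where "k = p div 4"
  have pk: "p = 4 * k + 1"
    using assms(2) unfolding k_def by presburger
  have k0: "k > 0"
    using assms(1) pk by (cases k) auto
  interpret GAUSS p 2
    by unfold_locales (use assms pk k0 in \<open>auto simp: cong_def\<close>)
  have "E = (\<lambda>x. 2 * x) ` {int k <.. 2 * int k}"
  proof -
    have A: "A = {0 <.. 2 * int k}"
      unfolding A_def by (simp add: pk)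
    \<comment> \<open>Doubles of \<open>1, ..., 2 * k\<close> stay below \<open>p\<close>, so
      reduction mod \<open>p\<close> leaves them alone. Those above \<open>2 * k\<close> are the
      doubles of the \<open>k\<close> numbers in \<open>{k <.. 2 * k}\<close>.\<close>
    have "C = (\<lambda>x. 2 * x) ` {0 <.. 2 * int k}"
      unfolding C_def B_def A image_image
      by (intro image_cong) (auto simp: pk)
    then show ?thesis
      unfolding E_def by (auto simp: pk)
  qed
  then have "card E = k"
    by (simp add: card_image inj_on_def)
  then have "Legendre 2 (int p) = (-1) ^ k"
    using gauss_lemma by simp
  moreover have "p mod 8 = 1 \<longleftrightarrow> even k"
    unfolding pk by presburger
  ultimately show ?thesis by simp
qed

lemma quad_symbol_eq_0_iff:
  "prime p \<Longrightarrow> quad_symbol a p = 0 \<longleftrightarrow> p dvd a"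
  unfolding quad_symbol_def
  by (cases "p = 2") (simp_all add: Legendre_eq_0_iff, presburger)

lemma quad_symbol_values: "quad_symbol a p \<in> {-1, 0, 1}"
  using Legendre_values by (simp add: quad_symbol_def)

lemma quad_symbol_mult:
  assumes "prime p"
  shows "quad_symbol (a * b) p = quad_symbol a p * quad_symbol b p"
proof (cases "p = 2")
  case True
  \<comment> \<open>At 2 the symbol depends only on residues mod 8, so checking the 64 pairs
    suffices.\<close>
  have "a mod 8 \<in> {0, 1, 2, 3, 4, 5, 6, 7}" "b mod 8 \<in> {0, 1, 2, 3, 4, 5, 6, 7}"
    by (simp_all, presburger+)
  moreover have "a * b mod 8 = (a mod 8) * (b mod 8) mod 8"
    by (simp add: mod_mult_eq)
  ultimately show ?thesis
    unfolding quad_symbol_def using True by (elim insertE emptyE; simp)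
next
  case False
  then have "2 < p"
    using assms prime_ge_2_nat[of p] by simp
  then show ?thesis
    using False Legendre_mult[OF assms] by (simp add: quad_symbol_def)
qed

lemma quad_symbol_1: "prime p \<Longrightarrow> quad_symbol 1 p = 1"
  using quad_symbol_mult[of p 1 1] quad_symbol_eq_0_iff[of p 1] by auto

lemma quad_symbol_prod:
  assumes "prime p"
  shows "quad_symbol (\<Prod>x\<in>A. f x) p = (\<Prod>x\<in>A. quad_symbol (f x) p)"
  using assms
  by (induction A rule: infinite_finite_induct)
     (simp_all add: quad_symbol_mult quad_symbol_1[simplified])

text \<open>For \<open>p mod 4 = 1\<close> the exponent in quadratic reciprocity is even and the
  sign disappears. For \<open>q = 2\<close> the convention for (p/2) agrees with the supplementary
  law for (2/p), as \<open>p mod 8\<close> is 1 or 5.\<close>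

lemma quad_symbol_reciprocity:
  assumes "prime p" "prime q" "p \<noteq> q" "p mod 4 = 1"
  shows "quad_symbol p q = quad_symbol q p"
proof -
  have p2: "2 < p"
    using assms(1,4) prime_ge_2_nat[of p] by (cases "p = 2") auto
  show ?thesis
  proof (cases "q = 2")
    case True
    then show ?thesis
      using p2 Legendre_2[OF assms(1,4)] assms(4) unfolding quad_symbol_def
      by (simp, presburger)
  next
    case False
    then have q2: "2 < q"
      using assms(2) prime_ge_2_nat[of q] by simp
    have "even ((p - 1) div 2)"
      using assms(4) by presburger
    then have "Legendre (int p) (int q) * Legendre (int q) (int p) = 1"
      using Quadratic_Reciprocity[OF assms(1) p2 assms(2) q2 assms(3)] by simp
    then show ?thesis
      using p2 q2 Legendre_values[of "int p" "int q"] by (auto simp: quad_symbol_def)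
  qed
qed

text \<open>As \<open>p mod 4 = 1\<close>, either sign \<open>s\<close> is a square mod
  \<open>p\<close>, so taking symbols on both sides compares \<open>u\<close> with \<open>v\<close>
  directly. Since \<open>v\<close> and \<open>y\<close> are units mod \<open>p\<close>, so is
  \<open>x\<close>, and both squares contribute 1.\<close>

lemma Legendre_eq_1_of_norm_cong:
  assumes "prime p" "p mod 4 = 1" "s \<in> {-1, 1}"
    and "[u * x\<^sup>2 = s * v * y\<^sup>2] (mod int p)"
    and "\<not> int p dvd u" "\<not> int p dvd v" "\<not> int p dvd y"
  shows "Legendre (u * v) (int p) = 1"
proof -
  have p2: "2 < p"
    using assms(1,2) prime_ge_2_nat[of p] by (cases "p = 2") auto
  note mult = Legendre_mult[OF assms(1) p2]
  have s: "Legendre s (int p) = 1"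
  proof -
    have "Legendre 1 (int p) = 1"
      using mult[of "-1" "-1"] Legendre_minus_1[OF assms(1,2)] by simp
    then show ?thesis
      using assms(3) Legendre_minus_1[OF assms(1,2)] by auto
  qed
  have "Legendre u (int p) * (Legendre x (int p))\<^sup>2 = Legendre v (int p) * (Legendre y (int p))\<^sup>2"
    using Legendre_cong[OF assms(4)] s by (simp add: mult power2_eq_square)
  moreover have "Legendre u (int p) \<noteq> 0" "Legendre v (int p) \<noteq> 0" "Legendre y (int p) \<noteq> 0"
    using assms(5-7) by (simp_all add: Legendre_eq_0_iff)
  ultimately show ?thesis
    using Legendre_values[of u "int p"] Legendre_values[of v "int p"]
      Legendre_values[of x "int p"] Legendre_values[of y "int p"]
    by (auto simp: mult)
qed

text \<open>
  The Jacobi symbol for square-free \<open>s\<close>. The prime 2 is included, with \<open>(a/2)\<close> as in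
  \<^const>\<open>quad_symbol\<close>: since \<open>(p/2) = (2/p)\<close> for primes \<open>p\<close> congruent to 1 modulo 4, reciprocity
  needs no separate treatment of even arguments.
\<close>

definition jacobi :: "nat \<Rightarrow> nat \<Rightarrow> int" where
  "jacobi a s = (\<Prod>p\<in>prime_factors s. quad_symbol a p)"

lemma jacobi_mult_left: "jacobi (a * b) s = jacobi a s * jacobi b s"
  unfolding jacobi_def prod.distrib[symmetric]
  by (intro prod.cong refl quad_symbol_mult) auto

lemma jacobi_mult_right:
  assumes "coprime s t" "s > 0" "t > 0"
  shows "jacobi a (s * t) = jacobi a s * jacobi a t"
proof -
  have "prime_factors s \<inter> prime_factors t = {}"
    using assms(1) by (auto simp: in_prime_factors_iff dest: coprime_common_divisor)
  then show ?thesis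
    unfolding jacobi_def using assms(2,3)
    by (simp add: prime_factors_product prod.union_disjoint)
qed

lemma squarefree_eq_prod_prime_factors:
  fixes s :: nat
  assumes "squarefree s"
  shows "(\<Prod>p\<in>prime_factors s. p) = s"
proof -
  have s0: "s \<noteq> 0" using assms by (metis not_squarefree_0)
  have "(\<Prod>p\<in>prime_factors s. p) = (\<Prod>p\<in>prime_factors s. p ^ multiplicity p s)"
    using assms by (intro prod.cong) (auto simp: squarefree_factorial_semiring'[OF s0])
  also have "\<dots> = s"
    using prod_prime_factors[OF s0] by simp
  finally show ?thesis .
qed

text \<open>Both sides expand into a double product over pairs of primes. Each pair is flipped
  without a sign because the prime from \<open>s\<close> is 1 mod 4, and then the two products are
  interchanged.\<close>

lemma jacobi_reciprocity:
  assumes "squarefree s" "squarefree t" "coprime s t"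
    and "\<And>p. prime p \<Longrightarrow> p dvd s \<Longrightarrow> p mod 4 = 1"
  shows "jacobi s t = jacobi t s"
proof -
  have "jacobi s t = (\<Prod>q\<in>prime_factors t. \<Prod>p\<in>prime_factors s. quad_symbol p q)"
    unfolding jacobi_def
    by (subst squarefree_eq_prod_prime_factors[OF assms(1), symmetric])
       (auto intro!: prod.cong quad_symbol_prod)
  also have "\<dots> = (\<Prod>q\<in>prime_factors t. \<Prod>p\<in>prime_factors s. quad_symbol q p)"
  proof (intro prod.cong refl quad_symbol_reciprocity)
    fix q p assume "q \<in> prime_factors t" "p \<in> prime_factors s"
    then show "prime p" "prime q" "p mod 4 = 1"
      using assms(4) by (auto simp: in_prime_factors_iff)
    show "p \<noteq> q"
      using \<open>q \<in> prime_factors t\<close> \<open>p \<in> prime_factors s\<close> assms(3)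
      by (auto simp: in_prime_factors_iff dest: coprime_common_divisor)
  qed
  also have "\<dots> = (\<Prod>p\<in>prime_factors s. \<Prod>q\<in>prime_factors t. quad_symbol q p)"
    by (rule prod.swap)
  also have "\<dots> = jacobi t s"
    unfolding jacobi_def
  proof (intro prod.cong refl)
    fix p assume "p \<in> prime_factors s"
    then show "(\<Prod>q\<in>prime_factors t. quad_symbol q p) = quad_symbol t p"
      using quad_symbol_prod[of p "\<lambda>q. q" "prime_factors t"]
        squarefree_eq_prod_prime_factors[OF assms(2)]
      by (auto simp: in_prime_factors_iff)
  qed
  finally show ?thesis .
qed

section \<open>The norm form \<open>a\<^sup>2 - m n b\<^sup>2\<close>\<close>

lemma squarefree_mult_imp_coprime:
  fixes a b :: nat
  assumes "squarefree (a * b)"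
  shows "coprime a b"
proof (rule coprimeI)
  fix c assume "c dvd a" "c dvd b"
  then have "c\<^sup>2 dvd a * b"
    by (simp add: mult_dvd_mono power2_eq_square)
  then show "is_unit c"
    using assms by (rule squarefreeD[rotated])
qed

text \<open>Let \<open>g\<close> be the gcd of \<open>k\<close> and \<open>a\<close>, with cofactor
  \<open>h\<close>. A prime dividing \<open>h\<close> would divide \<open>a\<close>, hence also
  \<open>g\<close>, although \<open>g\<close> and \<open>h\<close> are coprime; so
  \<open>h = 1\<close>.\<close>

lemma squarefree_dvd_square_imp_dvd:
  fixes k :: nat and a :: int
  assumes "squarefree k" "int k dvd a\<^sup>2"
  shows "int k dvd a"
proof -
  define g where "g = gcd k (nat \<bar>a\<bar>)"
  have "g dvd k" unfolding g_def by (rule gcd_dvd1)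
  then obtain h where h: "k = g * h" by (elim dvdE)
  have cop: "coprime g h"
    using squarefree_mult_imp_coprime assms(1) h by simp
  have "h = 1"
  proof (rule ccontr)
    assume "h \<noteq> 1"
    then obtain p where p: "prime p" "p dvd h"
      using prime_factor_nat by blast
    then have "p dvd k" by (simp add: h)
    then have "int p dvd a\<^sup>2"
      using assms(2) by (meson dvd_trans int_dvd_int_iff)
    then have "int p dvd a"
      using p(1) prime_dvd_power[of "int p"] by simp
    then have "p dvd nat \<bar>a\<bar>"
      by (simp add: nat_dvd_iff int_dvd_int_iff[symmetric])
    then have "p dvd g"
      unfolding g_def using \<open>p dvd k\<close> by (intro gcd_greatest)
    then show False
      using cop p by (meson coprime_common_divisor not_prime_unit)
  qed
  then have "k dvd nat \<bar>a\<bar>"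
    using h g_def by (metis gcd_dvd2 mult.right_neutral)
  then have "int k dvd int (nat \<bar>a\<bar>)"
    by (simp only: int_dvd_int_iff)
  then show ?thesis by simp
qed

lemma prime_dvd_square_times:
  fixes r :: nat and b :: int
  assumes "prime p" "\<not> p dvd r" "int p dvd int r * b\<^sup>2"
  shows "int p dvd b"
proof -
  have P: "prime (int p)" using assms(1) by simp
  have "int p dvd b\<^sup>2"
    using assms(2,3) P by (simp add: prime_dvd_mult_iff)
  then show ?thesis
    using P prime_dvd_power by blast
qed

text \<open>Only the primes of \<open>m\<close> are examined locally: those of
  \<open>m' = m / d1\<close> give (d/m') = 1 and those of \<open>d1\<close> give (m' n d2/d1) = 1.
  Reciprocity combines the two into (n/d1)(m/d2) = 1.\<close>

lemma jacobi_norm_form: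
  fixes m n d :: nat and a b c s :: int
  assumes "squarefree m" "squarefree n" "coprime m n" "squarefree d" "s \<in> {-1, 1}"
    and m1: "\<And>p. prime p \<Longrightarrow> p dvd m \<Longrightarrow> p mod 4 = 1"
    and eq: "a\<^sup>2 - int (m * n) * b\<^sup>2 = s * int d * c\<^sup>2"
    and prim: "\<And>p. prime p \<Longrightarrow> \<not> (int p dvd a \<and> int p dvd b \<and> int p dvd c)"
  shows "jacobi n (gcd d m) * jacobi m (d div gcd d m) = 1"
proof -
  define d1 where "d1 = gcd d m"
  define d2 where "d2 = d div d1"
  define m' where "m' = m div d1"
  have pos: "m > 0" "d > 0"
    using assms(1,4) by (metis gr0I not_squarefree_0)+
  have d1pos: "d1 > 0"
    using pos by (simp add: d1_def)
  have d: "d = d1 * d2" and m: "m = d1 * m'"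
    by (simp_all add: d1_def d2_def m'_def)
  have sqf: "squarefree d1" "squarefree d2" "squarefree m'"
    using assms(1,4) d m squarefree_multD by metis+
  have cop: "coprime d1 d2" "coprime d1 m'"
    using assms(1,4) d m squarefree_mult_imp_coprime by metis+
  have "coprime d2 m'"
    using div_gcd_coprime[of d m] pos by (simp add: d1_def d2_def m'_def)
  with cop have cop2: "coprime d2 m'" "coprime d2 m" "coprime d m'"
    by (simp_all add: d m ac_simps)
  have copn: "coprime n d1" "coprime n m'"
    using assms(3) by (simp_all add: m ac_simps)
  have not_dvd: "\<not> p dvd y" if "coprime x y" "prime p" "p dvd x" for p x y :: nat
    using that by (meson coprime_common_divisor not_prime_unit)
  have symb: "quad_symbol x p = Legendre (int x) (int p)" if "prime p" "p dvd m" for x p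
    using m1[OF that] by (auto simp: quad_symbol_def)
  have pos': "m' > 0" "d2 > 0"
    using pos d m by auto

  \<comment> \<open>Modulo a prime \<open>p\<close> of \<open>m'\<close> the equation reads
    \<open>a^2 = s * d * c^2\<close>, which gives (d/p) = 1 once \<open>p\<close> is known not to
    divide \<open>c\<close>.\<close>
  have "jacobi d m' = 1"
    unfolding jacobi_def
  proof (intro prod.neutral ballI)
    fix p assume "p \<in> prime_factors m'"
    then have p: "prime p" "p dvd m'" "p dvd m"
      by (auto simp: in_prime_factors_iff m)
    have P: "prime (int p)" using p by simp
    have pd: "\<not> p dvd d"
      using not_dvd[of m' d p] p cop2 by (simp add: ac_simps)
    have pmn: "int p dvd int (m * n) * b\<^sup>2"
      using p(3) by simp
    have cong: "[1 * a\<^sup>2 = s * int d * c\<^sup>2] (mod int p)"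
      using pmn eq by (simp add: cong_iff_dvd_diff flip: eq)
    have "\<not> int p dvd c"
    proof
      \<comment> \<open>If \<open>p\<close> divides \<open>c\<close>, it divides \<open>a\<close>,
        so \<open>p^2\<close> divides \<open>m * n * b^2\<close>. But \<open>p\<close> divides
        \<open>m * n\<close> exactly once, so it divides \<open>b\<close> too, against
        primitivity.\<close>
      assume pc: "int p dvd c"
      then have "int p dvd s * int d * c\<^sup>2 + int (m * n) * b\<^sup>2"
        by (intro dvd_add[OF _ pmn] dvd_mult) (simp add: power2_eq_square)
      then have "int p dvd a\<^sup>2"
        using eq by (simp add: algebra_simps)
      then have pa: "int p dvd a"
        using P prime_dvd_power by blast
      obtain r where r: "m = p * r" using p(3) by (elim dvdE)
      have "coprime p r"
        using assms(1) r squarefree_mult_imp_coprime by simp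
      then have "\<not> p dvd r * n"
        using not_dvd[of p r p] not_dvd[of m n p] p assms(3) by (simp add: prime_dvd_mult_iff)
      moreover have "int p * int p dvd int p * (int (r * n) * b\<^sup>2)"
      proof -
        have "int p * int p dvd a\<^sup>2 - s * int d * c\<^sup>2"
          using pa pc by (intro dvd_diff dvd_mult) (simp_all add: power2_eq_square mult_dvd_mono)
        also have "\<dots> = int p * (int (r * n) * b\<^sup>2)"
          using eq by (simp add: r algebra_simps)
        finally show ?thesis .
      qed
      then have "int p dvd int (r * n) * b\<^sup>2"
        using p(1) by (simp add: prime_gt_0_nat del: of_nat_mult)
      ultimately have "int p dvd b"
        using prime_dvd_square_times p(1) by blast
      then show False
        using prim[OF p(1)] pa pc by blast
    qed
    then have "Legendre (1 * int d) (int p) = 1"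
      using pd P not_prime_unit[of "int p"] p(1)
      by (intro Legendre_eq_1_of_norm_cong[OF p(1) m1[OF p(1,3)] assms(5) cong]) auto
    then show "quad_symbol d p = 1"
      using symb[OF p(1,3)] by simp
  qed
  then have A: "jacobi d1 m' * jacobi d2 m' = 1"
    by (simp add: d jacobi_mult_left)

  \<comment> \<open>Here \<open>d1\<close> divides both \<open>d\<close> and \<open>m\<close>, hence
    \<open>a^2\<close>, hence \<open>a\<close> by square-freeness. One factor \<open>d1\<close> can
    then be cancelled from the whole equation.\<close>
  have "int d1 dvd s * int d * c\<^sup>2 + int (m * n) * b\<^sup>2"
    by (intro dvd_add) (simp_all add: d m)
  then have "int d1 dvd a\<^sup>2"
    using eq by (simp add: algebra_simps)
  then obtain a1 where a1: "a = int d1 * a1"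
    using squarefree_dvd_square_imp_dvd[OF sqf(1)] by (metis dvdE)
  have "int d1 * (int d1 * a1\<^sup>2 - int (m' * n) * b\<^sup>2) = int d1 * (s * int d2 * c\<^sup>2)"
    using eq by (simp add: a1 d m power2_eq_square algebra_simps)
  then have eq1: "int d1 * a1\<^sup>2 - int (m' * n) * b\<^sup>2 = s * int d2 * c\<^sup>2"
    using d1pos by simp
  \<comment> \<open>Modulo a prime of \<open>d1\<close> the reduced equation reads
    \<open>m' * n * b^2 = - s * d2 * c^2\<close>. The sign is now \<open>- s\<close>, still a square
    there. A prime dividing \<open>c\<close> would divide \<open>b\<close>, and it divides
    \<open>a\<close> through \<open>d1\<close>.\<close>
  have "jacobi (m' * n * d2) d1 = 1"
    unfolding jacobi_def
  proof (intro prod.neutral ballI)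
    fix p assume "p \<in> prime_factors d1"
    then have p: "prime p" "p dvd d1" "p dvd m"
      by (auto simp: in_prime_factors_iff m)
    have nd: "\<not> p dvd m' * n" "\<not> p dvd d2"
      using not_dvd[of d1 m' p] not_dvd[of d1 n p] not_dvd[of d1 d2 p] p cop copn
      by (simp_all add: prime_dvd_mult_iff ac_simps)
    have "int (m' * n) * b\<^sup>2 - (- s) * int d2 * c\<^sup>2 = int d1 * a1\<^sup>2"
      using eq1 by simp
    then have cong: "[int (m' * n) * b\<^sup>2 = (- s) * int d2 * c\<^sup>2] (mod int p)"
      using p(2) by (simp add: cong_iff_dvd_diff)
    have "\<not> int p dvd c"
    proof
      assume pc: "int p dvd c"
      have "int p dvd int d1 * a1\<^sup>2 - s * int d2 * c\<^sup>2"
        using p(2) pc by (intro dvd_diff dvd_mult[of _ "c\<^sup>2"]) (simp_all add: power2_eq_square)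
      then have "int p dvd int (m' * n) * b\<^sup>2"
        using eq1 by (simp add: algebra_simps)
      then have "int p dvd b"
        using prime_dvd_square_times nd(1) p(1) by blast
      then show False
        using prim[OF p(1)] pc p(2) by (simp add: a1)
    qed
    moreover have "- s \<in> {-1, 1}"
      using assms(5) by auto
    ultimately have "Legendre (int (m' * n) * int d2) (int p) = 1"
      using nd by (intro Legendre_eq_1_of_norm_cong[OF p(1) m1[OF p(1,3)] _ cong])
                  (simp_all del: of_nat_mult)
    then show "quad_symbol (m' * n * d2) p = 1"
      using symb[OF p(1,3)] by simp
  qed
  then have B: "jacobi m' d1 * jacobi n d1 * jacobi d2 d1 = 1"
    by (simp add: jacobi_mult_left)

  have R1: "jacobi m d2 = jacobi d2 m"
    using jacobi_reciprocity[OF assms(1) sqf(2) _ m1] cop2 by (simp add: ac_simps)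
  have R2: "jacobi m' d1 = jacobi d1 m'"
    using jacobi_reciprocity[OF sqf(3,1)] m1 cop(2) by (simp add: ac_simps m)
  have S: "jacobi d2 m = jacobi d2 d1 * jacobi d2 m'"
    unfolding m using cop(2) d1pos pos' by (intro jacobi_mult_right)
  \<comment> \<open>Integers with product 1 are equal, so \<open>A\<close> gives (d2/m') = (d1/m'),
    which is (m'/d1) by \<open>R2\<close>. In \<open>B\<close> the factors (m'/d1) and (d2/d1) then
    combine to (d2/m) = (m/d2).\<close>
  have "jacobi d2 m' = jacobi m' d1"
    using A R2 by (auto simp: zmult_eq_1_iff)
  then have "jacobi n d1 * jacobi m d2 = 1"
    using B R1 S by (simp add: ac_simps)
  then show ?thesis
    by (simp add: d1_def d2_def)
qed

section \<open>From a product of symbols to the parity of a set of primes\<close>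

lemma prod_signs_eq_minus_1_power:
  fixes f :: "'a \<Rightarrow> int"
  assumes "finite A" "\<And>x. x \<in> A \<Longrightarrow> f x \<in> {-1, 1}"
  shows "prod f A = (-1) ^ card {x \<in> A. f x = -1}"
proof -
  have "prod f A = (\<Prod>x\<in>A. if f x = -1 then -1 else 1)"
    using assms(2) by (intro prod.cong) auto
  also have "\<dots> = (-1) ^ card {x \<in> A. f x = -1}"
    using assms(1) by (simp add: prod.If_cases Int_def)
  finally show ?thesis .
qed

lemma mod_4_eq_1_of_primes:
  fixes m :: nat
  assumes "m > 0" "\<And>p. prime p \<Longrightarrow> p dvd m \<Longrightarrow> p mod 4 = 1"
  shows "m mod 4 = 1"
  using assms
proof (induction m rule: prime_divisors_induct)
  case (factor p x)
  then have "p mod 4 = 1" "x mod 4 = 1" by auto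
  then show ?case by (metis mod_mult_eq mult_1 mod_mod_trivial)
qed auto

lemma even_card_P_set:
  fixes m n d :: nat and a b c s :: int
  assumes "squarefree m" "squarefree n" "coprime m n" "squarefree d" "s \<in> {-1, 1}"
    and m1: "\<And>p. prime p \<Longrightarrow> p dvd m \<Longrightarrow> p mod 4 = 1"
    and dvd: "if n mod 4 = 3 then d dvd 2 * m * n else d dvd m * n"
    and eq: "a\<^sup>2 - int (m * n) * b\<^sup>2 = s * int d * c\<^sup>2"
    and prim: "\<And>p. prime p \<Longrightarrow> \<not> (int p dvd a \<and> int p dvd b \<and> int p dvd c)"
  shows "even (card ({p. prime p \<and> p dvd d} \<inter> P_set m n))"
proof -
  \<comment> \<open>For \<open>p\<close> dividing \<open>d\<close>, this single symbol decides
    membership in \<open>P_set m n\<close>, including the case where \<open>p = 2\<close> divides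
    neither \<open>m\<close> nor \<open>n\<close>.\<close>
  define f where "f p = quad_symbol (if p dvd m then n else m) p" for p
  have pos: "m > 0" "d > 0"
    using assms(1,4) by (metis gr0I not_squarefree_0)+
  have m4: "m mod 4 = 1"
    using pos(1) m1 by (rule mod_4_eq_1_of_primes)
  have f_sign: "f p \<in> {-1, 1}" if "prime p" for p
  proof -
    have "\<not> p dvd (if p dvd m then n else m)"
      using assms(3) that by (auto dest: coprime_common_divisor)
    then have "f p \<noteq> 0"
      using that by (simp add: f_def quad_symbol_eq_0_iff)
    then show ?thesis
      using quad_symbol_values[of "if p dvd m then n else m" p] by (auto simp: f_def)
  qed
  have P_iff: "p \<in> P_set m n \<longleftrightarrow> f p = -1" if p: "prime p" "p dvd d" for p
  proof (cases "p dvd m")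
    case True
    then have "\<not> p dvd n" "p \<noteq> 2"
      using assms(3) p m1[OF p(1)] by (auto dest: coprime_common_divisor)
    then show ?thesis
      using True p by (auto simp: P_set_def P_two_def f_def)
  next
    case False
    show ?thesis
    proof (cases "p dvd n")
      case True
      \<comment> \<open>Membership in \<open>P_two\<close> would mean \<open>p = 2\<close> with
        \<open>n\<close> odd, but \<open>p\<close> divides \<open>n\<close>.\<close>
      then have "p \<notin> P_two m n"
        by (auto simp: P_two_def) presburger
      then show ?thesis
        using True False p by (auto simp: P_set_def f_def)
    next
      case pn: False
      \<comment> \<open>A prime of \<open>d\<close> outside \<open>m * n\<close> can only come from
        the extra factor 2 that is allowed when \<open>n mod 4 = 3\<close>.\<close>
      have "n mod 4 = 3 \<and> p = 2"
      proof -
        have "p dvd (if n mod 4 = 3 then 2 * m * n else m * n)"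
          using dvd p(2) by (auto split: if_splits dest: dvd_trans)
        then show ?thesis
          using p(1) pn False
          by (auto split: if_splits simp: prime_dvd_mult_iff primes_dvd_imp_eq)
      qed
      then have n3: "n mod 4 = 3" and p2: "p = 2" by auto
      \<comment> \<open>With \<open>m mod 4 = 1\<close>, the condition (m/2) = -1 becomes
        \<open>m mod 8 = 5\<close>, as in \<open>P_two\<close>.\<close>
      have "m mod 8 = 1 \<or> m mod 8 = 5"
        using m4 by presburger
      then show ?thesis
        using False pn n3 p2 by (auto simp: P_set_def P_two_def f_def quad_symbol_def)
    qed
  qed

  define d1 where "d1 = gcd d m"
  define d2 where "d2 = d div d1"
  have d: "d = d1 * d2"
    by (simp add: d1_def d2_def)
  have pos': "d1 \<noteq> 0" "d2 \<noteq> 0"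
    using d pos by auto
  have cop: "coprime d1 d2"
    using assms(4) d squarefree_mult_imp_coprime by metis
  have disj: "prime_factors d1 \<inter> prime_factors d2 = {}"
    using cop by (auto simp: in_prime_factors_iff dest: coprime_common_divisor)
  \<comment> \<open>Primes of \<open>d1\<close> divide \<open>m\<close> and contribute (n/p). Primes
    of \<open>d2\<close> cannot divide \<open>m\<close>, since they would then divide
    \<open>d1\<close> as well, so they contribute (m/p).\<close>
  have "prod f (prime_factors d) = prod f (prime_factors d1) * prod f (prime_factors d2)"
    unfolding d using pos' disj by (simp add: prime_factors_product prod.union_disjoint)
  also have "prod f (prime_factors d1) = jacobi n d1"
    unfolding jacobi_def f_def by (intro prod.cong) (auto simp: in_prime_factors_iff d1_def)
  also have "prod f (prime_factors d2) = jacobi m d2"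
    unfolding jacobi_def
  proof (intro prod.cong refl)
    fix p assume p: "p \<in> prime_factors d2"
    then have "p dvd d"
      by (auto simp: d)
    then have "\<not> p dvd m"
      using p disj pos' by (auto simp: in_prime_factors_iff d1_def)
    then show "f p = quad_symbol m p"
      by (simp add: f_def)
  qed
  also have "jacobi n d1 * jacobi m d2 = 1"
    using jacobi_norm_form[OF assms(1-5) m1 eq prim] by (simp add: d1_def d2_def)
  finally have "(-1 :: int) ^ card {p \<in> prime_factors d. f p = -1} = 1"
    using prod_signs_eq_minus_1_power[of "prime_factors d" f] f_sign by auto
  then have "even (card {p \<in> prime_factors d. f p = -1})"
    using neg_one_odd_power[where 'a = int] by fastforce
  moreover have "{p. prime p \<and> p dvd d} \<inter> P_set m n = {p \<in> prime_factors d. f p = -1}"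
    using P_iff pos by (auto simp: in_prime_factors_iff)
  ultimately show ?thesis by simp
qed

section \<open>Quadratic extensions of subfields of the reals\<close>

abbreviation real_ring :: "real ring" where
  "real_ring \<equiv> ring_of_type_algebra"

lemma field_real_ring: "field real_ring" and cring_real_ring: "cring real_ring"
  and ring_real_ring: "ring real_ring"
  by (rule field_from_type_algebra cring_from_type_algebra ring_from_type_algebra)+

lemma real_ring_simps [simp]:
  "carrier real_ring = UNIV" "\<one>\<^bsub>real_ring\<^esub> = 1" "\<zero>\<^bsub>real_ring\<^esub> = 0"
  "x \<otimes>\<^bsub>real_ring\<^esub> y = x * y" "x \<oplus>\<^bsub>real_ring\<^esub> y = x + y"
  by (simp_all add: ring_of_type_algebra_def)

lemma real_ring_minus [simp]: "\<ominus>\<^bsub>real_ring\<^esub> x = - x"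
  using abelian_group.minus_equality[OF ring.axioms(1)[OF ring_real_ring], of "- x" x] by simp

lemma real_ring_inv [simp]: "x \<noteq> 0 \<Longrightarrow> inv\<^bsub>real_ring\<^esub> x = inverse x"
  using comm_monoid.comm_inv_char[OF cring.axioms(2)[OF cring_real_ring], of x "inverse x"]
  by simp

lemma real_subfieldI:
  assumes "1 \<in> K"
    and "\<And>x. x \<in> K \<Longrightarrow> - x \<in> K" "\<And>x. x \<in> K \<Longrightarrow> x \<noteq> 0 \<Longrightarrow> inverse x \<in> K"
    and "\<And>x y. x \<in> K \<Longrightarrow> y \<in> K \<Longrightarrow> x + y \<in> K" "\<And>x y. x \<in> K \<Longrightarrow> y \<in> K \<Longrightarrow> x * y \<in> K"
  shows "subfield K real_ring"
  using assms by (intro field.subfieldI'[OF field_real_ring] ring.subringI[OF ring_real_ring]) auto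

lemma real_subfieldD:
  assumes "subfield K real_ring"
  shows "0 \<in> K" "1 \<in> K" "\<And>x. x \<in> K \<Longrightarrow> - x \<in> K" "\<And>x. x \<in> K \<Longrightarrow> inverse x \<in> K"
    and "\<And>x y. x \<in> K \<Longrightarrow> y \<in> K \<Longrightarrow> x + y \<in> K" "\<And>x y. x \<in> K \<Longrightarrow> y \<in> K \<Longrightarrow> x - y \<in> K"
    and "\<And>x y. x \<in> K \<Longrightarrow> y \<in> K \<Longrightarrow> x * y \<in> K" "\<And>x y. x \<in> K \<Longrightarrow> y \<in> K \<Longrightarrow> x / y \<in> K"
proof -
  note E = subringE[OF subfieldE(1)[OF assms], simplified]
  show zero: "0 \<in> K" and "1 \<in> K" by (rule E(2), rule E(3))
  show minus: "- x \<in> K" if "x \<in> K" for x using E(5)[OF that] .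
  show add: "x + y \<in> K" and mult: "x * y \<in> K" if "x \<in> K" "y \<in> K" for x y
    using E that by auto
  show inv: "inverse x \<in> K" if "x \<in> K" for x
    using ring.subfield_m_inv(1)[OF ring_real_ring assms, of x] that zero by (cases "x = 0") auto
  show "x - y \<in> K" "x / y \<in> K" if "x \<in> K" "y \<in> K" for x y
    using add[OF that(1) minus[OF that(2)]] mult[OF that(1) inv[OF that(2)]]
    by (simp_all add: divide_inverse)
qed

lemma subfield_Rats: "subfield \<rat> real_ring"
  by (rule real_subfieldI) auto

lemma subfield_adjoin: "subfield (adjoin K x) real_ring"
  unfolding adjoin_def by (rule field.generate_field_is_subfield[OF field_real_ring]) simp

lemma mem_adjoin: "x \<in> adjoin K x" and subset_adjoin: "K \<subseteq> adjoin K x"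
  unfolding adjoin_def by (auto intro: generate_field.incl)

text \<open>Inverses come from multiplying by the conjugate \<open>u - v * x\<close>. The case that
  \<open>x\<close> already lies in \<open>K\<close> is included, so the conjugate of a nonzero
  element may vanish.\<close>

lemma subfield_quadratic:
  assumes K: "subfield K real_ring" and x: "x\<^sup>2 \<in> K"
  shows "subfield {u + v * x | u v. u \<in> K \<and> v \<in> K} real_ring" (is "subfield ?L _")
proof (rule real_subfieldI)
  note K' = real_subfieldD[OF K]
  have I: "z \<in> ?L" if "z = u + v * x" "u \<in> K" "v \<in> K" for u v z
    using that by blast
  show "1 \<in> ?L" by (rule I[of _ 1 0]) (auto intro: K')
  show "- z \<in> ?L" if "z \<in> ?L" for z
  proof -
    from that obtain u v where "z = u + v * x" "u \<in> K" "v \<in> K" by blast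
    then show ?thesis by (intro I[of _ "- u" "- v"]) (auto intro: K')
  qed
  show "z + w \<in> ?L" if "z \<in> ?L" "w \<in> ?L" for z w
  proof -
    from that obtain u v u' v' where "z = u + v * x" "u \<in> K" "v \<in> K"
      "w = u' + v' * x" "u' \<in> K" "v' \<in> K" by blast
    then show ?thesis
      by (intro I[of _ "u + u'" "v + v'"]) (auto intro: K' simp: algebra_simps)
  qed
  show "z * w \<in> ?L" if "z \<in> ?L" "w \<in> ?L" for z w
  proof -
    from that obtain u v u' v' where zw: "z = u + v * x" "w = u' + v' * x"
      and K: "u \<in> K" "v \<in> K" "u' \<in> K" "v' \<in> K" by blast
    have "z * w = (u * u' + v * v' * x\<^sup>2) + (u * v' + v * u') * x"
      unfolding zw by (simp add: algebra_simps power2_eq_square)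
    moreover have "u * u' + v * v' * x\<^sup>2 \<in> K" "u * v' + v * u' \<in> K"
      using K x by (simp_all add: K')
    ultimately show ?thesis by (rule I)
  qed
  show "inverse z \<in> ?L" if "z \<in> ?L" "z \<noteq> 0" for z
  proof -
    from that obtain u v where z: "z = u + v * x" "u \<in> K" "v \<in> K" by blast
    show ?thesis
    proof (cases "u - v * x = 0")
      case True
      then have "z = 2 * u" using z by simp
      then have "inverse z = inverse (u + u) + 0 * x" by simp
      moreover have "inverse (u + u) \<in> K"
        by (intro K'(4,5) z(2))
      ultimately show ?thesis by (rule I) (rule K'(1))
    next
      case False
      define w where "w = u * u - v * v * x\<^sup>2"
      have "w = z * (u - v * x)"
        by (simp add: w_def z algebra_simps power2_eq_square)
      then have "inverse z = (u - v * x) / w"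
        using False that(2) by (simp add: divide_simps)
      then have "inverse z = u / w + (- v / w) * x"
        by (simp add: diff_divide_distrib)
      moreover have "w \<in> K"
        unfolding w_def using z x by (simp add: K')
      moreover have "u / w \<in> K" "- v / w \<in> K"
        using z(2,3) \<open>w \<in> K\<close> by (simp_all only: K')
      ultimately show ?thesis by (intro I)
    qed
  qed
qed

text \<open>The generated field is the smallest subfield containing \<open>K\<close> and
  \<open>x\<close>, and the set on the right is such a subfield.\<close>

lemma adjoin_subset_quadratic:
  assumes K: "subfield K real_ring" and x: "x\<^sup>2 \<in> K"
  shows "adjoin K x \<subseteq> {u + v * x | u v. u \<in> K \<and> v \<in> K}" (is "_ \<subseteq> ?L")
  unfolding adjoin_def
proof (rule field.generate_field_min_subfield1[OF field_real_ring])
  show "subfield ?L real_ring" using assms by (rule subfield_quadratic)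
  show "insert x K \<subseteq> ?L"
  proof
    fix z assume "z \<in> insert x K"
    then have "z = 0 + 1 * x \<or> z = z + 0 * x \<and> z \<in> K" by auto
    then show "z \<in> ?L" using real_subfieldD(1,2)[OF K] by blast
  qed
qed simp

text \<open>This is Kummer theory in degree two. Squaring \<open>sqrt y = u + v * sqrt x\<close>
  makes the cross term vanish, so \<open>sqrt y\<close> is a \<open>K\<close>-multiple of
  \<open>sqrt x\<close>.\<close>

lemma sqrt_mult_mem_of_adjoin_eq:
  assumes K: "subfield K real_ring" and "x \<in> K" "y \<in> K" "x > 0" "y > 0"
    and eq: "adjoin K (sqrt x) = adjoin K (sqrt y)"
  shows "sqrt (x * y) \<in> K"
proof -
  note K' = real_subfieldD[OF K]
  have L: "adjoin K (sqrt z) \<subseteq> {u + v * sqrt z | u v. u \<in> K \<and> v \<in> K}" if "z \<in> K" "z > 0" for z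
    using that by (intro adjoin_subset_quadratic[OF K]) auto
  \<comment> \<open>A root already in \<open>K\<close> generates nothing new, so if one of the two
    roots lies in \<open>K\<close>, both do.\<close>
  have sub: "adjoin K (sqrt z) \<subseteq> K" if "sqrt z \<in> K" "z \<in> K" "z > 0" for z
    using L[OF that(2,3)] that(1) by (auto intro: K')
  show ?thesis
  proof (cases "sqrt x \<in> K \<or> sqrt y \<in> K")
    case True
    then have "sqrt x \<in> K" "sqrt y \<in> K"
      using sub[of x] sub[of y] assms mem_adjoin[of "sqrt x" K] mem_adjoin[of "sqrt y" K] by auto
    then show ?thesis by (simp add: real_sqrt_mult K')
  next
    case False
    have "sqrt y \<in> adjoin K (sqrt x)"
      using mem_adjoin eq by auto
    then obtain u v where uv: "sqrt y = u + v * sqrt x" "u \<in> K" "v \<in> K"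
      using L[of x] assms by blast
    have "y = (u + v * sqrt x)\<^sup>2"
      using uv(1) \<open>y > 0\<close> by (metis less_imp_le real_sqrt_pow2)
    also have "\<dots> = u\<^sup>2 + v\<^sup>2 * x + (2 * u * v) * sqrt x"
      using \<open>x > 0\<close> by (simp add: power2_sum power_mult_distrib algebra_simps)
    finally have y: "(2 * u * v) * sqrt x = y - u\<^sup>2 - v\<^sup>2 * x" by simp
    have "2 * u * v = 0"
    proof (rule ccontr)
      assume nz: "2 * u * v \<noteq> 0"
      then have "sqrt x = (y - u * u - v * v * x) / (u * v + u * v)"
        using y by (simp add: field_simps power2_eq_square)
      then have "sqrt x \<in> K"
        using assms(2,3) uv(2,3) by (metis K'(5,6,7,8))
      then show False using False by simp
    qed
    \<comment> \<open>If \<open>v = 0\<close>, then \<open>sqrt y = u\<close> would lie in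
      \<open>K\<close>. Hence \<open>u = 0\<close>.\<close>
    moreover have "v \<noteq> 0"
      using uv False by auto
    ultimately have "sqrt y = v * sqrt x"
      using uv(1) by simp
    then have "sqrt (x * y) = v * x"
      using \<open>x > 0\<close> by (simp add: real_sqrt_mult)
    then show ?thesis
      using uv assms(2) by (simp add: K')
  qed
qed

section \<open>Rational coordinates and norms in real quadratic fields\<close>

lemma sqrt_squarefree_irrational:
  fixes D :: nat
  assumes "squarefree D" "D > 1"
  shows "sqrt (real D) \<notin> \<rat>"
proof
  assume "sqrt (real D) \<in> \<rat>"
  moreover have "algebraic_int (sqrt (real D))"
    by (rule algebraic_int_sqrt) (rule algebraic_int_of_nat)
  ultimately have "sqrt (real D) \<in> \<int>"
    by (intro rational_algebraic_int_is_int)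
  then obtain k where k: "sqrt (real D) = real k"
    by (metis Ints_cases int_eq_iff of_int_of_nat_eq of_nat_0_le_iff of_int_0_le_iff
        real_sqrt_ge_zero)
  then have "real (k\<^sup>2) = real D"
    by (metis of_nat_0_le_iff of_nat_power real_sqrt_pow2)
  then have D: "D = k\<^sup>2" by (simp only: of_nat_eq_iff)
  then have "k dvd 1"
    using assms(1) by (intro squarefreeD[of D]) auto
  then show False using D assms(2) by simp
qed

lemma quad_coords_unique:
  fixes D :: nat
  assumes "sqrt (real D) \<notin> \<rat>" "a \<in> \<rat>" "b \<in> \<rat>" "a' \<in> \<rat>" "b' \<in> \<rat>"
    and eq: "a + b * sqrt (real D) = a' + b' * sqrt (real D)"
  shows "a = a' \<and> b = b'"
proof -
  have "b = b'"
  proof (rule ccontr)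
    assume "b \<noteq> b'"
    then have "sqrt (real D) = (a' - a) / (b - b')"
      using eq by (simp add: field_simps)
    then show False using assms by simp
  qed
  then show ?thesis using eq by simp
qed

text \<open>Irrationality of \<open>sqrt D\<close> makes the coordinates unique, so the definite
  description in \<open>quad_norm\<close> denotes this value.\<close>

lemma quad_norm_eq:
  fixes D :: nat
  assumes "sqrt (real D) \<notin> \<rat>" "a \<in> \<rat>" "b \<in> \<rat>"
  shows "quad_norm D (a + b * sqrt (real D)) = a\<^sup>2 - real D * b\<^sup>2"
  unfolding quad_norm_def
proof (rule the_equality)
  have N: "(u + v * sqrt (real D)) * (u - v * sqrt (real D)) = u\<^sup>2 - real D * v\<^sup>2" for u v
    by (simp add: algebra_simps power2_eq_square)
  show "\<exists>u\<in>\<rat>. \<exists>v\<in>\<rat>. a + b * sqrt (real D) = u + v * sqrt (real D) \<and>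
      a\<^sup>2 - real D * b\<^sup>2 = (u + v * sqrt (real D)) * (u - v * sqrt (real D))"
    using assms(2,3) N by metis
  show "M = a\<^sup>2 - real D * b\<^sup>2"
    if "\<exists>u\<in>\<rat>. \<exists>v\<in>\<rat>. a + b * sqrt (real D) = u + v * sqrt (real D) \<and>
      M = (u + v * sqrt (real D)) * (u - v * sqrt (real D))" for M
    using that quad_coords_unique[OF assms] N by metis
qed

lemma quad_field_cases:
  assumes "z \<in> quad_field D"
  obtains a b where "a \<in> \<rat>" "b \<in> \<rat>" "z = a + b * sqrt (real D)"
  using adjoin_subset_quadratic[OF subfield_Rats, of "sqrt (real D)"] assms by auto

text \<open>Over the common denominator \<open>C\<close> the equation becomes integral and
  homogeneous, so the gcd of all three entries can be divided out.\<close>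

lemma norm_form_primitive_solution:
  fixes x y :: real and D :: nat and t :: int
  assumes "x \<in> \<rat>" "y \<in> \<rat>" "x\<^sup>2 - real D * y\<^sup>2 = of_int t"
  obtains a b c :: int where "a\<^sup>2 - int D * b\<^sup>2 = t * c\<^sup>2"
    and "\<And>p. prime p \<Longrightarrow> \<not> (int p dvd a \<and> int p dvd b \<and> int p dvd c)"
proof -
  obtain i j where x: "x = of_int i / of_int j" "j > 0"
    using assms(1) by (elim Rats_cases') auto
  obtain k l where y: "y = of_int k / of_int l" "l > 0"
    using assms(2) by (elim Rats_cases') auto
  define A where "A = i * l"
  define B where "B = k * j"
  define C where "C = j * l"
  have C0: "C \<noteq> 0" using x y by (simp add: C_def)
  have xy: "x = of_int A / of_int C" "y = of_int B / of_int C"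
    using x y by (simp_all add: A_def B_def C_def)
  define g where "g = gcd A (gcd B C)"
  have g0: "g \<noteq> 0" using C0 by (simp add: g_def)
  have "g dvd A" "g dvd B" "g dvd C"
    unfolding g_def by (meson gcd_dvd1 gcd_dvd2 dvd_trans)+
  then obtain a b c where abc: "A = g * a" "B = g * b" "C = g * c"
    by (elim dvdE)
  have c0: "c \<noteq> 0" using C0 abc by auto
  have xy': "x = of_int a / of_int c" "y = of_int b / of_int c"
    using xy g0 by (simp_all add: abc)
  have "(of_int a)\<^sup>2 - real D * (of_int b)\<^sup>2 = of_int t * (of_int c)\<^sup>2"
    using assms(3) c0 unfolding xy' by (simp add: power_divide field_simps)
  then have "real_of_int (a\<^sup>2 - int D * b\<^sup>2) = real_of_int (t * c\<^sup>2)"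
    by simp
  then have "a\<^sup>2 - int D * b\<^sup>2 = t * c\<^sup>2"
    by (simp only: of_int_eq_iff)
  moreover have "\<not> (int p dvd a \<and> int p dvd b \<and> int p dvd c)" if "prime p" for p
  proof
    assume "int p dvd a \<and> int p dvd b \<and> int p dvd c"
    then have "g * int p dvd A" "g * int p dvd B" "g * int p dvd C"
      by (simp_all add: abc)
    \<comment> \<open>A common prime \<open>p\<close> of \<open>a\<close>, \<open>b\<close>,
      \<open>c\<close> would make \<open>g * p\<close> a common divisor of \<open>A\<close>,
      \<open>B\<close>, \<open>C\<close>, hence a divisor of their gcd \<open>g\<close>.\<close>
    then have "g * int p dvd g * 1"
      by (simp add: g_def)
    then have "int p dvd 1"
      using g0 by (subst (asm) dvd_mult_cancel_left) simp
    then show False using that by auto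
  qed
  ultimately show thesis by (rule that)
qed

theorem theorem6p5:
  fixes m n d :: nat and e :: real
  assumes "m > 0" and "n > 0"
    and "squarefree m" and "squarefree n"
    and "gcd m n = 1"
    and "positive_fundamental_unit (quad_field (m * n)) e"
    and "quad_norm (m * n) e = 1"
    and "\<And>p. prime p \<Longrightarrow> p dvd m \<Longrightarrow> p mod 4 = 1"
    and "d > 0" and "squarefree d"
    and "adjoin (quad_field (m * n)) (sqrt e) = adjoin (quad_field (m * n)) (sqrt (real d))"
    and "if n mod 4 = 3 then d dvd 2 * m * n else d dvd m * n"
  shows "even (card ({p. prime p \<and> p dvd d} \<inter> P_set m n))"
proof (cases "m * n = 1")
  case True
  \<comment> \<open>In this degenerate case \<open>sqrt (m * n)\<close> is rational and coordinates
    are not unique; but \<open>n = 1\<close>, so \<open>d\<close> divides 1.\<close>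
  then have "d = 1" using assms(12) by simp
  then have "{p. prime p \<and> p dvd d} = {}" by auto
  then show ?thesis by (simp only: Int_empty_left card.empty even_zero)
next
  case False
  define D where "D = m * n"
  have cop: "coprime m n" using assms(5) by (simp only: coprime_iff_gcd_eq_1)
  have "squarefree D"
    unfolding D_def using cop assms(3,4) by (rule squarefree_mult_coprime)
  moreover have "D > 1"
    using False assms(1,2) unfolding D_def by (metis One_nat_def Suc_lessI nat_0_less_mult_iff)
  ultimately have irr: "sqrt (real D) \<notin> \<rat>"
    by (rule sqrt_squarefree_irrational)
  have F: "subfield (quad_field D) real_ring"
    by (rule subfield_adjoin)
  have e: "e \<in> quad_field D" "e > 0"
    using assms(6) by (auto simp: positive_fundamental_unit_def integer_units_def
        ring_of_integers_def D_def)
  obtain a b where ab: "a \<in> \<rat>" "b \<in> \<rat>" "e = a + b * sqrt (real D)"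
    using e(1) by (rule quad_field_cases)
  have norm: "a\<^sup>2 - real D * b\<^sup>2 = 1"
    using assms(7) quad_norm_eq[OF irr ab(1,2)] ab(3) by (simp add: D_def)
  have "real d \<in> quad_field D"
    using subset_adjoin[of \<rat>] Rats_of_nat by blast
  \<comment> \<open>Equal quadratic extensions make \<open>e * d\<close> a square in the field;
    \<open>x\<close> and \<open>y\<close> below are the coordinates of its root.\<close>
  then have "sqrt (e * real d) \<in> quad_field D"
    using e assms(9,11) by (intro sqrt_mult_mem_of_adjoin_eq[OF F]) (simp_all add: D_def)
  then obtain x y where xy: "x \<in> \<rat>" "y \<in> \<rat>" "sqrt (e * real d) = x + y * sqrt (real D)"
    by (rule quad_field_cases)
  have "real d * a + real d * b * sqrt (real D) = (sqrt (e * real d))\<^sup>2"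
    using e(2) by (simp add: ab(3)[symmetric] algebra_simps) (simp add: ab(3) algebra_simps)
  also have "\<dots> = (x\<^sup>2 + real D * y\<^sup>2) + (2 * x * y) * sqrt (real D)"
    unfolding xy(3) by (simp add: power2_sum power_mult_distrib algebra_simps)
  finally have "real d * a = x\<^sup>2 + real D * y\<^sup>2 \<and> real d * b = 2 * x * y"
    using ab(1,2) xy(1,2) by (intro quad_coords_unique[OF irr]) simp_all
  then have co: "x\<^sup>2 + real D * y\<^sup>2 = real d * a" "2 * x * y = real d * b" by simp_all
  \<comment> \<open>The squared norm of the root is the norm of \<open>e * d\<close>, which is
    \<open>d^2\<close> because \<open>e\<close> has norm 1. The root itself has norm
    \<open>d\<close> or \<open>- d\<close>, recorded by the sign \<open>s\<close>.\<close>
  have "(x\<^sup>2 - real D * y\<^sup>2)\<^sup>2 = (x\<^sup>2 + real D * y\<^sup>2)\<^sup>2 - real D * (2 * x * y)\<^sup>2"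
    by (simp add: power2_eq_square algebra_simps)
  also have "\<dots> = (real d)\<^sup>2 * (a\<^sup>2 - real D * b\<^sup>2)"
    unfolding co by (simp add: power2_eq_square algebra_simps)
  finally have "(x\<^sup>2 - real D * y\<^sup>2)\<^sup>2 = (real d)\<^sup>2"
    using norm by simp
  then have "x\<^sup>2 - real D * y\<^sup>2 = real d \<or> x\<^sup>2 - real D * y\<^sup>2 = - real d"
    by (simp add: power2_eq_iff)
  then obtain s :: int where s: "s \<in> {-1, 1}" "x\<^sup>2 - real D * y\<^sup>2 = of_int (s * int d)"
  proof
    assume "x\<^sup>2 - real D * y\<^sup>2 = real d"
    then show thesis by (intro that[of 1]) simp_all
  next
    assume "x\<^sup>2 - real D * y\<^sup>2 = - real d"
    then show thesis by (intro that[of "-1"]) simp_all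
  qed
  obtain u v w where "u\<^sup>2 - int D * v\<^sup>2 = s * int d * w\<^sup>2"
    and "\<And>p. prime p \<Longrightarrow> \<not> (int p dvd u \<and> int p dvd v \<and> int p dvd w)"
    using norm_form_primitive_solution[OF xy(1,2) s(2)] by blast
  then show ?thesis
    using even_card_P_set[OF assms(3,4) cop assms(10) s(1) assms(8,12)] unfolding D_def by blast
qed

end
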